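(* Let $\mathbb{A}$ be a locally complex algebra. Then $\mathbb{A}$ is equipped with a unique vector space norm $\|\cdot\|$ that comes from an inner product and satisfies the identity $\|x^k\|=\|x\|^k$ on $\mathbb{A}$ for all $k\in\mathbb{N}$.
   Context: Algebras are nonzero and not necessarily associative or commutative. A unital algebra is quadratic if the unital subalgebra generated by any element is at most two-dimensional (such algebras are power-associative). A real quadratic algebra is locally complex if the unital subalgebra generated by any element is a field extension of $\mathbb{R}$ (i.e. isomorphic to $\mathbb{R}$ or $\mathbb{C}$). *)

theory Defs
  imports "HOL-Algebra.Ring" "HOL-Analysis.Linear_Algebra"
begin

text \<open>
  Real algebras are not assumed associative or commutative, so the multiplication
  \<open>mul\<close> and the unit \<open>e\<close> are parameters on an arbitrary, possibly
  infinite-dimensional, real vector space.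
\<close>

locale unital_real_algebra =
  fixes mul :: "'a::real_vector \<Rightarrow> 'a \<Rightarrow> 'a" and e :: 'a
  assumes bilinear_mul: "bilinear mul"
    and unit_left: "mul e x = x"
    and unit_right: "mul x e = x"
    and nonzero: "\<exists>x :: 'a. x \<noteq> 0"
begin

definition unital_subalgebra :: "'a set \<Rightarrow> bool" where
  "unital_subalgebra S \<longleftrightarrow>
     subspace S \<and> e \<in> S \<and> (\<forall>x\<in>S. \<forall>y\<in>S. mul x y \<in> S)"

definition generated_subalgebra :: "'a \<Rightarrow> 'a set" where
  "generated_subalgebra x = unital_subalgebra hull {x}"

definition subalgebra_ring :: "'a set \<Rightarrow> 'a ring" where
  "subalgebra_ring S = \<lparr>carrier = S, mult = mul, one = e, zero = 0, add = (+)\<rparr>"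

text \<open>
  In the quadratic case all bracketings of a power agree; this one is
  \<open>x (x (\<dots> (x e)))\<close>, with \<open>apower x 0 = e\<close>.
\<close>

definition apower :: "'a \<Rightarrow> nat \<Rightarrow> 'a" where
  "apower x k = (mul x ^^ k) e"

end

text \<open>
  The dimension bound is stated with an explicit finite basis because
  \<^const>\<open>dim\<close> is \<open>0\<close> on infinite-dimensional subspaces.
\<close>

locale quadratic_real_algebra = unital_real_algebra +
  assumes dim_generated_le_2:
    "\<exists>B. finite B \<and> card B \<le> 2 \<and> independent B \<and> span B = generated_subalgebra x"

text \<open>
  A generated subalgebra that is a field is automatically an extension of the reals,
  embedded as the multiples \<open>r *\<^sub>R e\<close> of the unit.
\<close>

locale locally_complex_algebra = quadratic_real_algebra +
  assumes field_generated: "field (subalgebra_ring (generated_subalgebra x))"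

definition vector_space_norm :: "('a::real_vector \<Rightarrow> real) \<Rightarrow> bool" where
  "vector_space_norm N \<longleftrightarrow>
     (\<forall>x. 0 \<le> N x) \<and>
     (\<forall>x. N x = 0 \<longleftrightarrow> x = 0) \<and>
     (\<forall>r x. N (r *\<^sub>R x) = \<bar>r\<bar> * N x) \<and>
     (\<forall>x y. N (x + y) \<le> N x + N y)"

definition inner_product :: "('a::real_vector \<Rightarrow> 'a \<Rightarrow> real) \<Rightarrow> bool" where
  "inner_product ip \<longleftrightarrow>
     bilinear ip \<and>
     (\<forall>x y. ip x y = ip y x) \<and>
     (\<forall>x. x \<noteq> 0 \<longrightarrow> 0 < ip x x)"

definition comes_from_inner_product :: "('a::real_vector \<Rightarrow> real) \<Rightarrow> bool" where
  "comes_from_inner_product N \<longleftrightarrow>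
     (\<exists>ip. inner_product ip \<and> (\<forall>x. N x = sqrt (ip x x)))"

end

theory Submission imports Defs begin

text \<open>
  Every element satisfies \<open>x\<^sup>2 = t(x) x - n(x) e\<close> for a unique pair of reals
  once \<open>t(r e) = 2 r\<close> is imposed. Expanding \<open>(x + y)\<^sup>2 + (x - y)\<^sup>2 = 2 x\<^sup>2 + 2 y\<^sup>2\<close> shows
  that \<open>t\<close> is linear, so \<open>n\<close> is a quadratic form, and \<open>n\<close> is positive definite because
  a real root of \<open>X\<^sup>2 - t(x) X + n(x)\<close> would give zero divisors in the field generated
  by \<open>x\<close>. On the span of \<open>e\<close> and \<open>x\<close> the form \<open>n\<close> is multiplicative, hence \<open>\<surd>n\<close> is a
  norm as required. Conversely, if \<open>t(w) = 0\<close>, comparing the norms of \<open>w \<plusminus> e\<close> and of their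
  squares forces \<open>w\<close> to be orthogonal to \<open>e\<close> and to have squared norm \<open>n(w)\<close>.
\<close>

section \<open>The quadratic equation of a single element\<close>

context unital_real_algebra
begin

lemmas mul_simps =
  bilinear_ladd[OF bilinear_mul] bilinear_radd[OF bilinear_mul]
  bilinear_lmul[OF bilinear_mul] bilinear_rmul[OF bilinear_mul]
  bilinear_lneg[OF bilinear_mul] bilinear_rneg[OF bilinear_mul]
  bilinear_lsub[OF bilinear_mul] bilinear_rsub[OF bilinear_mul]
  bilinear_lzero[OF bilinear_mul] bilinear_rzero[OF bilinear_mul]
  unit_left unit_right

lemma e_nonzero [simp]: "e \<noteq> 0"
  using nonzero unit_left mul_simps by metis

lemma unital_subalgebra_generated: "unital_subalgebra (generated_subalgebra x)"
  unfolding generated_subalgebra_def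
  by (rule hull_in) (auto simp: unital_subalgebra_def subspace_Inter)

lemma generated_subalgebra_self: "x \<in> generated_subalgebra x"
  unfolding generated_subalgebra_def by (simp add: hull_inc)

lemma generated_subalgebra_affine: "a *\<^sub>R x + b *\<^sub>R e \<in> generated_subalgebra x"
  using unital_subalgebra_generated[of x] generated_subalgebra_self[of x]
  unfolding unital_subalgebra_def by (blast intro: subspace_add subspace_scale)

lemma apower_0: "apower x 0 = e"
  and apower_Suc: "apower x (Suc k) = mul x (apower x k)"
  by (simp_all add: apower_def)

text \<open>For \<open>x = r *\<^sub>R e\<close> the equation alone allows every \<open>t\<close>,
  with \<open>n = t * r - r\<^sup>2\<close>. The second conjunct picks the polynomial with double
  root \<open>r\<close>.\<close>

definition quadratic_coeffs :: "'a \<Rightarrow> real \<Rightarrow> real \<Rightarrow> bool" where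
  "quadratic_coeffs x t n \<longleftrightarrow>
     mul x x = t *\<^sub>R x - n *\<^sub>R e \<and> (\<forall>r. x = r *\<^sub>R e \<longrightarrow> t = 2 * r)"

lemma quadratic_coeffs_unique:
  assumes "quadratic_coeffs x t n" "quadratic_coeffs x t' n'"
  shows "t = t' \<and> n = n'"
proof -
  have eq: "(t - t') *\<^sub>R x = (n - n') *\<^sub>R e"
    using assms unfolding quadratic_coeffs_def by (simp add: algebra_simps)
  have "t = t'"
  proof (rule ccontr)
    assume "t \<noteq> t'"
    then have "x = ((n - n') / (t - t')) *\<^sub>R e"
      using arg_cong[OF eq, of "scaleR (inverse (t - t'))"] by (simp add: divide_inverse mult.commute)
    then have "t = t'"
      using assms unfolding quadratic_coeffs_def by metis
    with \<open>t \<noteq> t'\<close> show False by contradiction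
  qed
  with eq show ?thesis by (simp add: e_nonzero)
qed

text \<open>In terms of roots: replacing \<open>x\<close> by
  \<open>a *\<^sub>R x + b *\<^sub>R e\<close> sends each root \<open>z\<close> of X^2 - t X + n to
  \<open>a * z + b\<close>; the new coefficients are the sum and the product of these
  images.\<close>

lemma quadratic_coeffs_affine:
  assumes "quadratic_coeffs x t n"
  shows "quadratic_coeffs (a *\<^sub>R x + b *\<^sub>R e) (a * t + 2 * b) (a\<^sup>2 * n + a * b * t + b\<^sup>2)"
proof -
  have sq: "mul x x = t *\<^sub>R x - n *\<^sub>R e"
    using assms by (simp add: quadratic_coeffs_def)
  \<comment> \<open>Expanding the square yields the cross term twice; this splits the factor 2 on
    the other side to match.\<close>
  have double: "(c * (d * 2)) *\<^sub>R z = (c * d) *\<^sub>R z + (c * d) *\<^sub>R z" for c d and z :: 'a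
    by (simp flip: scaleR_left_distrib)
  have "a * t + 2 * b = 2 * r" if r: "a *\<^sub>R x + b *\<^sub>R e = r *\<^sub>R e" for r
  proof (cases "a = 0")
    case True
    with r show ?thesis by simp
  next
    case False
    have eq: "a *\<^sub>R x = (r - b) *\<^sub>R e"
      using r by (simp add: algebra_simps)
    have "x = ((r - b) / a) *\<^sub>R e"
      using False arg_cong[OF eq, of "scaleR (inverse a)"] by (simp add: divide_inverse mult.commute)
    then have "t = 2 * ((r - b) / a)"
      using assms unfolding quadratic_coeffs_def by blast
    with False show ?thesis by simp
  qed
  moreover have "mul (a *\<^sub>R x + b *\<^sub>R e) (a *\<^sub>R x + b *\<^sub>R e) =
      (a * t + 2 * b) *\<^sub>R (a *\<^sub>R x + b *\<^sub>R e) - (a\<^sup>2 * n + a * b * t + b\<^sup>2) *\<^sub>R e"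
    by (simp add: mul_simps sq algebra_simps power2_eq_square double)
  ultimately show ?thesis
    unfolding quadratic_coeffs_def by blast
qed

end

section \<open>Trace and norm form of a quadratic algebra\<close>

lemma in_span_scaleR_iff: "c *\<^sub>R x \<in> span S \<longleftrightarrow> c = 0 \<or> x \<in> span S"
proof (cases "c = 0")
  case False
  then have "x = inverse c *\<^sub>R (c *\<^sub>R x)" by simp
  then show ?thesis
    using False span_scale by metis
qed (simp add: span_zero)

context quadratic_real_algebra
begin

lemma quadratic_coeffs_exist: "\<exists>t n. quadratic_coeffs x t n"
proof (cases "x \<in> span {e}")
  case True
  then obtain r where "x = r *\<^sub>R e"
    by (auto simp: span_singleton)
  then have "quadratic_coeffs x (2 * r) (r\<^sup>2)"
    by (auto simp: quadratic_coeffs_def mul_simps power2_eq_square simp flip: scaleR_left_diff_distrib)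
  then show ?thesis by blast
next
  case False
  have ind: "independent {x, e}"
    using False e_nonzero by (simp add: independent_insert)
  \<comment> \<open>Otherwise the square, \<open>x\<close> and \<open>e\<close> would be three
    distinct independent vectors in a subalgebra spanned by at most two.\<close>
  have "mul x x \<in> span {x, e}"
  proof (rule ccontr)
    assume new: "mul x x \<notin> span {x, e}"
    then have "independent {mul x x, x, e}"
      using ind by (simp add: independent_insert)
    moreover obtain B where B: "finite B" "card B \<le> 2" "span B = generated_subalgebra x"
      using dim_generated_le_2 by blast
    moreover have "{mul x x, x, e} \<subseteq> span B"
      using unital_subalgebra_generated[of x] generated_subalgebra_self[of x] B(3)
      by (auto simp: unital_subalgebra_def)
    ultimately have "card {mul x x, x, e} \<le> 2"
      using independent_span_bound[of B "{mul x x, x, e}"] by linarith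
    moreover have "mul x x \<notin> {x, e}" "x \<noteq> e"
      using new False span_base by blast+
    ultimately show False by simp
  qed
  then obtain t s where "mul x x - t *\<^sub>R x = s *\<^sub>R e"
    unfolding span_insert[of x] by (auto simp: span_singleton)
  then have "mul x x = t *\<^sub>R x - (- s) *\<^sub>R e"
    by (simp add: algebra_simps)
  moreover have "x \<noteq> r *\<^sub>R e" for r
    using False by (auto simp: span_singleton)
  ultimately have "quadratic_coeffs x t (- s)"
    by (simp add: quadratic_coeffs_def)
  then show ?thesis by blast
qed

definition trace :: "'a \<Rightarrow> real" where
  "trace x = (THE t. \<exists>n. quadratic_coeffs x t n)"

definition qnorm :: "'a \<Rightarrow> real" where
  "qnorm x = (THE n. \<exists>t. quadratic_coeffs x t n)"

lemma trace_qnorm_eqI: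
  assumes "quadratic_coeffs x t n"
  shows "trace x = t" "qnorm x = n"
  unfolding trace_def qnorm_def using assms quadratic_coeffs_unique by blast+

lemma quadratic_coeffs_trace_qnorm: "quadratic_coeffs x (trace x) (qnorm x)"
  using quadratic_coeffs_exist[of x] trace_qnorm_eqI by blast

lemma mul_self: "mul x x = trace x *\<^sub>R x - qnorm x *\<^sub>R e"
  using quadratic_coeffs_trace_qnorm by (simp add: quadratic_coeffs_def)

lemma trace_affine: "trace (a *\<^sub>R x + b *\<^sub>R e) = a * trace x + 2 * b"
  and qnorm_affine: "qnorm (a *\<^sub>R x + b *\<^sub>R e) = a\<^sup>2 * qnorm x + a * b * trace x + b\<^sup>2"
  using trace_qnorm_eqI[OF quadratic_coeffs_affine[OF quadratic_coeffs_trace_qnorm]] by simp_all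

lemma trace_scaleR: "trace (a *\<^sub>R x) = a * trace x"
  and qnorm_scaleR: "qnorm (a *\<^sub>R x) = a\<^sup>2 * qnorm x"
  using trace_affine[of a x 0] qnorm_affine[of a x 0] by simp_all

lemma trace_e: "trace e = 2" and qnorm_e: "qnorm e = 1"
  using trace_affine[of 0 e 1] qnorm_affine[of 0 e 1] by simp_all

lemma trace_add: "trace (x + y) = trace x + trace y"
proof (cases "x \<in> span {e}")
  case True
  then obtain r where "x = r *\<^sub>R e"
    by (auto simp: span_singleton)
  then show ?thesis
    using trace_affine[of 1 y r] by (simp add: trace_scaleR trace_e add.commute)
next
  case x: False
  show ?thesis
  proof (cases "y \<in> span {x, e}")
    case True
    then obtain a b where y: "y = a *\<^sub>R x + b *\<^sub>R e"
      unfolding span_insert[of x] by (auto simp: span_singleton algebra_simps)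
    then have "x + y = (1 + a) *\<^sub>R x + b *\<^sub>R e"
      by (simp add: algebra_simps)
    then show ?thesis
      by (simp only: y trace_affine) (simp add: algebra_simps)
  next
    case y: False
    \<comment> \<open>\<open>p\<close>, \<open>q\<close> and \<open>s\<close> are the coefficients
      of \<open>x\<close>, \<open>y\<close> and \<open>e\<close> once the expanded squares are
      rewritten by \<open>mul_self\<close>. Independence of \<open>e\<close>, \<open>x\<close>,
      \<open>y\<close> kills \<open>p\<close> and \<open>q\<close>, and \<open>p + q = 0\<close> is
      additivity.\<close>
    define p where "p = trace (x + y) + trace (x - y) - 2 * trace x"
    define q where "q = trace (x + y) - trace (x - y) - 2 * trace y"
    define s where "s = qnorm (x + y) + qnorm (x - y) - 2 * qnorm x - 2 * qnorm y"
    have "mul (x + y) (x + y) + mul (x - y) (x - y) = 2 *\<^sub>R mul x x + 2 *\<^sub>R mul y y"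
      by (simp add: mul_simps scaleR_2)
    then have rel: "q *\<^sub>R y = s *\<^sub>R e - p *\<^sub>R x"
      unfolding mul_self p_def q_def s_def by (simp add: algebra_simps)
    then have "q *\<^sub>R y \<in> span {x, e}"
      by (simp add: span_base span_diff span_scale)
    then have "q = 0"
      using y in_span_scaleR_iff by blast
    with rel have "p *\<^sub>R x = s *\<^sub>R e" by simp
    then have "p *\<^sub>R x \<in> span {e}"
      by (simp add: span_base span_scale)
    then have "p = 0"
      using x in_span_scaleR_iff by blast
    with \<open>q = 0\<close> show ?thesis
      unfolding p_def q_def by linarith
  qed
qed

section \<open>Polarization and powers\<close>

definition polar :: "'a \<Rightarrow> 'a \<Rightarrow> real" where
  "polar x y = (qnorm (x + y) - qnorm x - qnorm y) / 2"

text \<open>The right-hand side is visibly linear in each argument, as \<open>trace\<close> is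
  linear. Since \<open>e\<close> is nonzero, bilinearity of \<open>polar\<close> can be read off
  after cancelling \<open>e\<close>.\<close>

lemma polar_scaleR_e:
  "(2 * polar x y) *\<^sub>R e = trace x *\<^sub>R y + trace y *\<^sub>R x - mul x y - mul y x"
proof -
  have n: "qnorm z *\<^sub>R e = trace z *\<^sub>R z - mul z z" for z
    by (simp add: mul_self)
  have "(2 * polar x y) *\<^sub>R e = qnorm (x + y) *\<^sub>R e - qnorm x *\<^sub>R e - qnorm y *\<^sub>R e"
    by (simp only: scaleR_left_diff_distrib[symmetric]) (simp add: polar_def)
  also have "\<dots> = trace x *\<^sub>R y + trace y *\<^sub>R x - mul x y - mul y x"
    unfolding n trace_add by (simp add: mul_simps algebra_simps)
  finally show ?thesis .
qed

lemma polar_commute: "polar x y = polar y x"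
  by (simp add: polar_def add.commute)

lemma polar_self: "polar x x = qnorm x"
  using qnorm_scaleR[of 2 x] by (simp add: polar_def scaleR_2)

lemma bilinear_polar: "bilinear polar"
proof -
  have "linear (polar x)" for x
  proof (rule linearI)
    fix y z r
    have "(2 * polar x (y + z)) *\<^sub>R e = (2 * polar x y + 2 * polar x z) *\<^sub>R e"
      unfolding scaleR_add_left polar_scaleR_e trace_add by (simp add: mul_simps algebra_simps)
    then show "polar x (y + z) = polar x y + polar x z"
      unfolding scaleR_cancel_right by simp
    have "(2 * polar x (r *\<^sub>R y)) *\<^sub>R e = r *\<^sub>R ((2 * polar x y) *\<^sub>R e)"
      unfolding polar_scaleR_e trace_scaleR by (simp add: mul_simps algebra_simps)
    then show "polar x (r *\<^sub>R y) = r *\<^sub>R polar x y"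
      by (simp add: e_nonzero)
  qed
  then show ?thesis
    unfolding bilinear_def using polar_commute by presburger
qed

lemma qnorm_apower: "qnorm (apower x k) = qnorm x ^ k"
proof -
  \<comment> \<open>The induction also carries membership in the span of \<open>x\<close> and
    \<open>e\<close>, where \<open>qnorm_affine\<close> computes the form explicitly.\<close>
  have "\<exists>a b. apower x k = a *\<^sub>R x + b *\<^sub>R e \<and> qnorm (apower x k) = qnorm x ^ k"
  proof (induction k)
    case 0
    have "apower x 0 = 0 *\<^sub>R x + 1 *\<^sub>R e"
      by (simp add: apower_0)
    then show ?case
      using qnorm_e by (metis apower_0 power_0)
  next
    case (Suc k)
    then obtain a b where ab: "apower x k = a *\<^sub>R x + b *\<^sub>R e"
      and IH: "qnorm (apower x k) = qnorm x ^ k" by blast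
    have eq: "apower x (Suc k) = (a * trace x + b) *\<^sub>R x + (- a * qnorm x) *\<^sub>R e"
      unfolding apower_Suc ab by (simp add: mul_simps mul_self algebra_simps)
    have "qnorm (apower x (Suc k)) = qnorm x * qnorm (apower x k)"
      unfolding eq unfolding ab qnorm_affine by (simp add: algebra_simps power2_eq_square)
    with IH have "qnorm (apower x (Suc k)) = qnorm x ^ Suc k" by simp
    with eq show ?case by blast
  qed
  then show ?thesis by blast
qed

end

section \<open>Positive definiteness and uniqueness\<close>

context locally_complex_algebra
begin

lemma generated_no_zero_divisors:
  assumes "y \<in> generated_subalgebra x" "z \<in> generated_subalgebra x" "mul y z = 0"
  shows "y = 0 \<or> z = 0"
proof -
  interpret F: field "subalgebra_ring (generated_subalgebra x)"
    by (rule field_generated)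
  show ?thesis
    using F.integral[of y z] assms by (simp add: subalgebra_ring_def)
qed

lemma qnorm_pos:
  assumes "x \<noteq> 0"
  shows "0 < qnorm x"
proof (rule ccontr)
  assume "\<not> 0 < qnorm x"
  \<comment> \<open>With \<open>qnorm x\<close> nonpositive the discriminant is nonnegative, so
    \<open>r\<close> and \<open>s\<close> below are real roots and the quadratic equation of
    \<open>x\<close> factors.\<close>
  define d where "d = sqrt ((trace x)\<^sup>2 - 4 * qnorm x)"
  have d: "d\<^sup>2 = (trace x)\<^sup>2 - 4 * qnorm x"
    using \<open>\<not> 0 < qnorm x\<close> unfolding d_def by (intro real_sqrt_pow2) (smt (verit) zero_le_power2)
  define r s where "r = (trace x + d) / 2" and "s = (trace x - d) / 2"
  have rs: "r + s = trace x" "r * s = qnorm x"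
    using d by (simp_all add: r_def s_def field_simps power2_eq_square)
  have "mul (x - r *\<^sub>R e) (x - s *\<^sub>R e) = 0"
    by (simp add: mul_simps mul_self algebra_simps flip: rs)
  then have "x - r *\<^sub>R e = 0 \<or> x - s *\<^sub>R e = 0"
    using generated_subalgebra_affine[of 1 x "- r"] generated_subalgebra_affine[of 1 x "- s"]
    by (intro generated_no_zero_divisors[of _ x]) simp_all
  \<comment> \<open>A vanishing factor makes \<open>x\<close> a scalar multiple of \<open>e\<close>;
    then \<open>qnorm x\<close> is a nonzero square, hence positive after all.\<close>
  then obtain c where c: "x = c *\<^sub>R e" by auto
  then have "qnorm x = c\<^sup>2"
    by (simp add: qnorm_scaleR qnorm_e)
  with c assms \<open>\<not> 0 < qnorm x\<close> show False by simp
qed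

lemma inner_product_polar: "inner_product polar"
  unfolding inner_product_def
  using bilinear_polar polar_commute polar_self qnorm_pos by simp

text \<open>The power identity enters through \<open>k = 2\<close>, which relates \<open>ip\<close>
  at a square to \<open>ip\<close> at its root, and \<open>k = 0\<close>, which normalizes
  \<open>e\<close>.\<close>

lemma power_norm_eq_qnorm:
  assumes ip: "inner_product ip" and N: "\<And>x. N x = sqrt (ip x x)"
    and pow: "\<And>x k. N (apower x k) = N x ^ k"
  shows "N x = sqrt (qnorm x)"
proof -
  have bil: "bilinear ip" and sym: "\<And>x y. ip x y = ip y x"
    and pos: "\<And>x. x \<noteq> 0 \<Longrightarrow> 0 < ip x x"
    using ip by (auto simp: inner_product_def)
  note ip_simps = bilinear_ladd[OF bil] bilinear_radd[OF bil] bilinear_lmul[OF bil]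
    bilinear_rmul[OF bil] bilinear_lzero[OF bil] bilinear_lneg[OF bil] bilinear_rneg[OF bil]
  have nonneg: "0 \<le> ip z z" for z
    using pos[of z] by (cases "z = 0") (auto simp: ip_simps)
  have sq: "ip (mul z z) (mul z z) = (ip z z)\<^sup>2" for z
  proof -
    have "N (mul z z) = (N z)\<^sup>2"
      using pow[of z 2] by (simp add: apower_Suc apower_0 unit_right numeral_2_eq_2)
    also have "\<dots> = ip z z"
      using nonneg by (simp add: N)
    finally have "sqrt (ip (mul z z) (mul z z)) = ip z z"
      by (simp add: N)
    then show ?thesis
      using nonneg by (metis real_sqrt_pow2)
  qed
  have ee: "ip e e = 1"
    using pow[of e 0] by (simp add: apower_0 N)
  \<comment> \<open>Real part and imaginary part of \<open>x\<close>: \<open>w\<close> has trace 0,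
    so its square is a multiple of \<open>e\<close>. The factor 1 in the next fact fits the shape of
    \<open>qnorm_affine\<close>.\<close>
  define r w where "r = trace x / 2" and "w = x - r *\<^sub>R e"
  have x: "x = 1 *\<^sub>R w + r *\<^sub>R e"
    by (simp add: w_def)
  have tw: "trace w = 0"
    using trace_affine[of 1 x "- r"] by (simp add: w_def r_def)
  then have ww: "mul w w = (- qnorm w) *\<^sub>R e"
    by (simp add: mul_self)
  have "(ip w w)\<^sup>2 = (qnorm w)\<^sup>2"
    using sq[of w] unfolding ww by (simp add: ip_simps ee power2_eq_square)
  moreover have "0 \<le> qnorm w"
    using qnorm_pos[of w] polar_self[of 0] bilinear_lzero[OF bilinear_polar] by (cases "w = 0") auto
  ultimately have iw: "ip w w = qnorm w"
    using nonneg[of w] by (simp add: power2_eq_iff_nonneg)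
  define c where "c = ip e w"
  have c: "ip e w = c" "ip w e = c"
    by (simp_all add: c_def sym)
  \<comment> \<open>This is \<open>sq\<close> at \<open>w + u *\<^sub>R e\<close> with common terms
    cancelled and a factor 4 removed. The left side is odd in \<open>u\<close> and the right side
    even, so adding the cases 1 and -1 gives \<open>c = 0\<close>: \<open>w\<close> is orthogonal to
    \<open>e\<close>.\<close>
  have key: "- 2 * u * qnorm w * c = u\<^sup>2 * c\<^sup>2" for u
  proof -
    have "mul (w + u *\<^sub>R e) (w + u *\<^sub>R e) = (u\<^sup>2 - qnorm w) *\<^sub>R e + (2 * u) *\<^sub>R w"
      by (simp add: mul_simps ww algebra_simps power2_eq_square) (simp flip: scaleR_left_distrib)
    from sq[of "w + u *\<^sub>R e", unfolded this]
    show ?thesis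
      by (simp add: ip_simps c iw ee) (simp add: algebra_simps power2_eq_square)
  qed
  have "c\<^sup>2 = 0"
    using key[of 1] key[of "- 1"] by simp
  then have "ip x x = qnorm w + r\<^sup>2"
    unfolding x using c iw ee by (simp add: ip_simps power2_eq_square)
  also have "\<dots> = qnorm x"
    unfolding x qnorm_affine using tw by simp
  finally show ?thesis by (simp add: N)
qed

end

section \<open>From inner products to norms, and the conclusion\<close>

lemma inner_product_vector_space_norm:
  assumes "inner_product ip"
  shows "vector_space_norm (\<lambda>x. sqrt (ip x x))"
proof -
  have bil: "bilinear ip" and sym: "\<And>x y. ip x y = ip y x"
    and pos: "\<And>x. x \<noteq> 0 \<Longrightarrow> 0 < ip x x"
    using assms by (auto simp: inner_product_def)
  note ip_simps = bilinear_ladd[OF bil] bilinear_radd[OF bil] bilinear_lmul[OF bil]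
    bilinear_rmul[OF bil] bilinear_lzero[OF bil] bilinear_lsub[OF bil] bilinear_rsub[OF bil]
  have nonneg: "0 \<le> ip z z" for z
    using pos[of z] by (cases "z = 0") (auto simp: ip_simps)
  have CS: "ip x y \<le> sqrt (ip x x) * sqrt (ip y y)" for x y
  proof (cases "x = 0 \<or> y = 0")
    case True
    then show ?thesis using sym by (auto simp: ip_simps)
  next
    case False
    define a b where "a = sqrt (ip x x)" and "b = sqrt (ip y y)"
    have ab: "0 < a" "0 < b" "ip x x = a\<^sup>2" "ip y y = b\<^sup>2"
      using False pos nonneg by (auto simp: a_def b_def)
    \<comment> \<open>Both \<open>b *\<^sub>R x\<close> and \<open>a *\<^sub>R y\<close> have length
      \<open>a * b\<close>, so expanding leaves a positive multiple of the Cauchy-Schwarz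
      defect.\<close>
    have "0 \<le> ip (b *\<^sub>R x - a *\<^sub>R y) (b *\<^sub>R x - a *\<^sub>R y)"
      by (rule nonneg)
    also have "\<dots> = 2 * (a * b) * (a * b - ip x y)"
      using sym[of y x] by (simp add: ip_simps ab) (simp add: algebra_simps power2_eq_square)
    finally have "0 \<le> 2 * (a * b) * (a * b - ip x y)" .
    moreover have "0 < 2 * (a * b)"
      using ab by simp
    ultimately have "0 \<le> a * b - ip x y"
      by (meson linorder_not_le mult_pos_neg)
    then show ?thesis by (simp add: a_def b_def)
  qed
  have "sqrt (ip (x + y) (x + y)) \<le> sqrt (ip x x) + sqrt (ip y y)" for x y
  proof (rule real_le_lsqrt)
    show "ip (x + y) (x + y) \<le> (sqrt (ip x x) + sqrt (ip y y))\<^sup>2"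
      using CS[of x y] nonneg sym[of y x] by (simp add: ip_simps power2_sum)
  qed (simp add: nonneg)
  moreover have "sqrt (ip x x) = 0 \<longleftrightarrow> x = 0" for x
    using pos[of x] by (cases "x = 0") (auto simp: ip_simps)
  moreover have "sqrt (ip (r *\<^sub>R x) (r *\<^sub>R x)) = \<bar>r\<bar> * sqrt (ip x x)" for r x
    by (simp add: ip_simps real_sqrt_mult flip: mult.assoc)
  ultimately show ?thesis
    unfolding vector_space_norm_def using nonneg by simp
qed

theorem theorem4p7:
  fixes mul :: "'a::real_vector \<Rightarrow> 'a \<Rightarrow> 'a" and e :: 'a
  assumes "locally_complex_algebra mul e"
  shows "\<exists>!N :: 'a \<Rightarrow> real.
           vector_space_norm N \<and> comes_from_inner_product N \<and>
           (\<forall>x. \<forall>k::nat. N (unital_real_algebra.apower mul e x k) = N x ^ k)"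
proof -
  interpret locally_complex_algebra mul e by (rule assms)
  show ?thesis
  \<comment> \<open>The witness is the norm of the inner product \<open>polar\<close>, whose
    diagonal is \<open>qnorm\<close>.\<close>
  proof (rule ex1I[of _ "\<lambda>x. sqrt (qnorm x)"], intro conjI allI)
    show "vector_space_norm (\<lambda>x. sqrt (qnorm x))"
      using inner_product_vector_space_norm[OF inner_product_polar] by (simp add: polar_self)
    show "comes_from_inner_product (\<lambda>x. sqrt (qnorm x))"
      unfolding comes_from_inner_product_def using inner_product_polar polar_self by metis
    show "sqrt (qnorm (apower x k)) = sqrt (qnorm x) ^ k" for x k
      by (simp add: qnorm_apower real_sqrt_power)
  next
    fix N :: "'a \<Rightarrow> real"
    assume "vector_space_norm N \<and> comes_from_inner_product N \<and>
      (\<forall>x. \<forall>k::nat. N (apower x k) = N x ^ k)"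
    then show "N = (\<lambda>x. sqrt (qnorm x))"
      unfolding comes_from_inner_product_def using power_norm_eq_qnorm by blast
  qed
qed

end
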